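(* Let $X_0\subset\mathbb{C}^2$ be the component $z^2-(1+x^2)z+2x^2-1=0$ of the $SL_2(\mathbb{C})$-character variety of the figure-eight knot complement, and let $\widetilde{X_0}\subset\mathbb{CP}^2$ be its smooth projective model $YZ^2-Y^2Z-X^2Z+2X^2Y-Y^3=0$, where $(x,z)\in\mathbb{C}^2$ is identified with $[x:1:z]$. Then $X_0$ has exactly two ideal points, $[1:0:0]$ and $[0:0:1]$.
   Context: For the figure-eight knot complement $M$ with $\pi_1(M)=\langle\alpha,\beta\mid\beta^{-1}\alpha^{-1}\beta\alpha\beta^{-1}\alpha\beta\alpha^{-1}\beta^{-1}\alpha\rangle$, the coordinates of a character $\chi$ are $x=\chi(\alpha)=\chi(\beta)$, $z=\chi(\alpha\beta)$; $X_0$ is the component of the character variety containing the characters of the discrete faithful representations. $[X:Y:Z]$ are homogeneous coordinates on $\mathbb{CP}^2$, with $x=X/Y$, $z=Z/Y$. The ideal points of $X_0$ are the points of $\widetilde{X_0}$ not lying in the affine curve $X_0$. *)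

theory Defs
  imports "HOL-Analysis.Analysis" "HOL-Algebra.Group" "HOL-Computational_Algebra.Polynomial"
begin

datatype letter = Alpha | Alpha_inv | Beta | Beta_inv

fun letter_inv :: "letter \<Rightarrow> letter" where
  "letter_inv Alpha = Alpha_inv"
| "letter_inv Alpha_inv = Alpha"
| "letter_inv Beta = Beta_inv"
| "letter_inv Beta_inv = Beta"

definition fig8_relator :: "letter list" where
  "fig8_relator = [Beta_inv, Alpha_inv, Beta, Alpha, Beta_inv, Alpha, Beta, Alpha_inv, Beta_inv, Alpha]"

inductive fig8_eq :: "letter list \<Rightarrow> letter list \<Rightarrow> bool" where
  refl: "fig8_eq u u"
| sym: "fig8_eq u v \<Longrightarrow> fig8_eq v u"
| trans: "fig8_eq u v \<Longrightarrow> fig8_eq v w \<Longrightarrow> fig8_eq u w"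
| cancel: "fig8_eq (u @ [l, letter_inv l] @ v) (u @ v)"
| relator: "fig8_eq (u @ fig8_relator @ v) (u @ v)"

definition fig8_rel :: "(letter list \<times> letter list) set" where
  "fig8_rel = {(u, v). fig8_eq u v}"

definition fig8_elem :: "letter list \<Rightarrow> letter list set" where
  "fig8_elem w = fig8_rel `` {w}"

definition fig8_group :: "letter list set monoid" where
  "fig8_group =
     \<lparr>carrier = UNIV // fig8_rel,
      monoid.mult = (\<lambda>C D. \<Union>u\<in>C. \<Union>v\<in>D. fig8_elem (u @ v)),
      one = fig8_elem []\<rparr>"

definition alpha :: "letter list set" where "alpha = fig8_elem [Alpha]"

definition beta :: "letter list set" where "beta = fig8_elem [Beta]"

definition SL2C :: "(complex ^ 2 ^ 2) monoid" where
  "SL2C = \<lparr>carrier = {A. det A = 1}, monoid.mult = (**), one = mat 1\<rparr>"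

definition fig8_reps :: "(letter list set \<Rightarrow> complex ^ 2 ^ 2) set" where
  "fig8_reps = hom fig8_group SL2C"

definition discrete_faithful :: "(letter list set \<Rightarrow> complex ^ 2 ^ 2) \<Rightarrow> bool" where
  "discrete_faithful \<rho> \<longleftrightarrow>
     \<rho> \<in> fig8_reps \<and> inj_on \<rho> (carrier fig8_group) \<and> discrete (\<rho> ` carrier fig8_group)"

definition character :: "(letter list set \<Rightarrow> complex ^ 2 ^ 2) \<Rightarrow> letter list set \<Rightarrow> complex" where
  "character \<rho> = (\<lambda>g. trace (\<rho> g))"

definition char_coords :: "(letter list set \<Rightarrow> complex) \<Rightarrow> complex \<times> complex" where
  "char_coords f = (f alpha, f (alpha \<otimes>\<^bsub>fig8_group\<^esub> beta))"

text \<open>The character variety, viewed in \<open>\<complex>\<^sup>2\<close> through the coordinates \<open>(x, z)\<close>.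
  Since \<open>\<alpha>\<close> and \<open>\<beta>\<close> are conjugate, \<open>x\<close> is also the value of the character at \<open>\<beta>\<close>.\<close>

definition fig8_char_variety :: "(complex \<times> complex) set" where
  "fig8_char_variety = char_coords ` character ` fig8_reps"

text \<open>A bivariate polynomial is a polynomial in \<open>z\<close> whose coefficients are polynomials in \<open>x\<close>.\<close>

definition eval2 :: "complex poly poly \<Rightarrow> complex \<Rightarrow> complex \<Rightarrow> complex" where
  "eval2 p x z = poly (poly p [:z:]) x"

definition affine_closed :: "(complex \<times> complex) set \<Rightarrow> bool" where
  "affine_closed V \<longleftrightarrow> (\<exists>P. V = {(x, z). \<forall>p\<in>P. eval2 p x z = 0})"

definition zariski_irreducible :: "(complex \<times> complex) set \<Rightarrow> bool" where
  "zariski_irreducible S \<longleftrightarrow>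
     S \<noteq> {} \<and>
     (\<forall>V W. affine_closed V \<longrightarrow> affine_closed W \<longrightarrow> S \<subseteq> V \<union> W \<longrightarrow> S \<subseteq> V \<or> S \<subseteq> W)"

definition irreducible_component ::
    "(complex \<times> complex) set \<Rightarrow> (complex \<times> complex) set \<Rightarrow> bool" where
  "irreducible_component S X \<longleftrightarrow>
     S \<subseteq> X \<and> zariski_irreducible S \<and>
     (\<forall>T. S \<subseteq> T \<longrightarrow> T \<subseteq> X \<longrightarrow> zariski_irreducible T \<longrightarrow> T = S)"

type_synonym triple = "complex \<times> complex \<times> complex"

definition proj_rel :: "(triple \<times> triple) set" where
  "proj_rel = {((X, Y, Z), (X', Y', Z')).
     (X, Y, Z) \<noteq> (0, 0, 0) \<and> (\<exists>c. c \<noteq> 0 \<and> X' = c * X \<and> Y' = c * Y \<and> Z' = c * Z)}"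

definition CP2 :: "triple set set" where
  "CP2 = (UNIV - {(0, 0, 0)}) // proj_rel"

text \<open>The point \<open>[X : Y : Z]\<close>; it is the empty set, hence not in \<open>CP2\<close>, if \<open>X = Y = Z = 0\<close>.\<close>

definition hpt :: "complex \<Rightarrow> complex \<Rightarrow> complex \<Rightarrow> triple set" where
  "hpt X Y Z = proj_rel `` {(X, Y, Z)}"

definition affine_embed :: "complex \<times> complex \<Rightarrow> triple set" where
  "affine_embed = (\<lambda>(x, z). hpt x 1 z)"

text \<open>A trivariate polynomial is a polynomial in \<open>Z\<close> over polynomials in \<open>Y\<close> over polynomials
  in \<open>X\<close>. As \<open>\<complex>\<close> is infinite, homogeneity can be expressed through values.\<close>

definition eval3 :: "complex poly poly poly \<Rightarrow> complex \<Rightarrow> complex \<Rightarrow> complex \<Rightarrow> complex" where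
  "eval3 F X Y Z = poly (poly (poly F [:[:Z:]:]) [:Y:]) X"

definition homogeneous :: "complex poly poly poly \<Rightarrow> bool" where
  "homogeneous F \<longleftrightarrow>
     (\<exists>d. \<forall>t X Y Z. eval3 F (t * X) (t * Y) (t * Z) = t ^ d * eval3 F X Y Z)"

definition proj_zeros :: "complex poly poly poly set \<Rightarrow> triple set set" where
  "proj_zeros P =
     {hpt X Y Z | X Y Z. (X, Y, Z) \<noteq> (0, 0, 0) \<and> (\<forall>F\<in>P. eval3 F X Y Z = 0)}"

definition proj_closed :: "triple set set \<Rightarrow> bool" where
  "proj_closed V \<longleftrightarrow> (\<exists>P. (\<forall>F\<in>P. homogeneous F) \<and> V = proj_zeros P)"

definition smooth_plane_curve :: "triple set set \<Rightarrow> bool" where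
  "smooth_plane_curve D \<longleftrightarrow>
     (\<exists>F. homogeneous F \<and> D = proj_zeros {F} \<and>
       (\<forall>X Y Z. (X, Y, Z) \<noteq> (0, 0, 0) \<longrightarrow> eval3 F X Y Z = 0 \<longrightarrow>
          \<not> (deriv (\<lambda>t. eval3 F t Y Z) X = 0 \<and>
             deriv (\<lambda>t. eval3 F X t Z) Y = 0 \<and>
             deriv (\<lambda>t. eval3 F X Y t) Z = 0)))"

text \<open>\<open>D\<close> is the smooth projective model of the affine curve \<open>C\<close>, where \<open>(x, z)\<close> is identified
  with \<open>[x : 1 : z]\<close>: a smooth projective curve containing \<open>C\<close> as a Zariski-open dense subset.
  The identification is an isomorphism onto the chart \<open>Y \<noteq> 0\<close>, so \<open>D\<close> is birational to \<open>C\<close>,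
  and \<open>D\<close> is irreducible if \<open>C\<close> is.\<close>

definition smooth_projective_model :: "(complex \<times> complex) set \<Rightarrow> triple set set \<Rightarrow> bool" where
  "smooth_projective_model C D \<longleftrightarrow>
     smooth_plane_curve D \<and>
     affine_embed ` C \<subseteq> D \<and>
     proj_closed (D - affine_embed ` C) \<and>
     (\<forall>V. proj_closed V \<longrightarrow> affine_embed ` C \<subseteq> V \<longrightarrow> D \<subseteq> V)"

definition ideal_points :: "(complex \<times> complex) set \<Rightarrow> triple set set \<Rightarrow> triple set set" where
  "ideal_points C D = D - affine_embed ` C"

definition X0 :: "(complex \<times> complex) set" where
  "X0 = {(x, z). z\<^sup>2 - (1 + x\<^sup>2) * z + 2 * x\<^sup>2 - 1 = 0}"

definition X0_model :: "triple set set" where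
  "X0_model = {hpt X Y Z | X Y Z. (X, Y, Z) \<noteq> (0, 0, 0) \<and>
     Y * Z\<^sup>2 - Y\<^sup>2 * Z - X\<^sup>2 * Z + 2 * X\<^sup>2 * Y - Y ^ 3 = 0}"

end

theory Submission
  imports Defs
begin

text \<open>
  Put \<open>W = \<alpha>\<^sup>-\<^sup>1 \<beta> \<alpha> \<beta>\<^sup>-\<^sup>1\<close>; the defining relation of the group is \<open>W \<alpha> = \<beta> W\<close>. For matrices \<open>A\<close>, \<open>B\<close>
  of determinant one with the same trace \<open>x\<close>, and with \<open>z = trace (A B)\<close>, Cayley--Hamilton gives
  \<open>W A - B W = (z\<^sup>2 - (1 + x\<^sup>2) z + 2 x\<^sup>2 - 1) (A - B)\<close>. Hence a representation has its character on
  \<open>X0\<close> or satisfies \<open>A = B\<close>, in which case \<open>z = x\<^sup>2 - 2\<close> and it is not faithful; conversely every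
  point of \<open>X0\<close> comes from a representation in Riley's normal form. The curve \<open>X0\<close> is irreducible
  because its equation, quadratic in \<open>z\<close>, has the discriminant \<open>(x\<^sup>2 - 1) (x\<^sup>2 - 5)\<close>, which is not a
  square; so \<open>X0\<close> is a component of its union with that parabola.
  On the line \<open>Y = 0\<close> the homogeneous equation becomes \<open>X\<^sup>2 Z = 0\<close>, which leaves the two ideal
  points, and both are limits of points of the affine curve.
\<close>

section \<open>Representations of the figure-eight knot group\<close>

lemma square_matrix_2_eq_iff:
  fixes A B :: "'a ^ 2 ^ 2"
  shows "A = B \<longleftrightarrow> A $ 1 $ 1 = B $ 1 $ 1 \<and> A $ 1 $ 2 = B $ 1 $ 2 \<and> A $ 2 $ 1 = B $ 2 $ 1 \<and> A $ 2 $ 2 = B $ 2 $ 2"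
  by (auto simp: vec_eq_iff forall_2)

lemma matrix_mult_2_nth [simp]:
  fixes A B :: "'a::semiring_1 ^ 2 ^ 2"
  shows "(A ** B) $ i $ j = A $ i $ 1 * B $ 1 $ j + A $ i $ 2 * B $ 2 $ j"
  by (simp add: matrix_matrix_mult_def sum_2)

lemma trace_2: "trace (A :: 'a::comm_semiring_1 ^ 2 ^ 2) = A $ 1 $ 1 + A $ 2 $ 2"
  by (simp add: trace_def sum_2)

text \<open>The inverse when the determinant is one, written as trace minus matrix so that words
  with inverses expand into polynomials in the generators.\<close>

definition adjugate2 :: "'a::comm_ring_1 ^ 2 ^ 2 \<Rightarrow> 'a ^ 2 ^ 2" where
  "adjugate2 A = mat (trace A) - A"

lemma adjugate2_mult:
  fixes A :: "'a::comm_ring_1 ^ 2 ^ 2"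
  assumes "det A = 1"
  shows "A ** adjugate2 A = mat 1" "adjugate2 A ** A = mat 1"
  using assms by (auto simp: square_matrix_2_eq_iff adjugate2_def trace_2 det_2 mat_def algebra_simps)

lemma det_adjugate2 [simp]: "det (adjugate2 A) = det (A :: 'a::comm_ring_1 ^ 2 ^ 2)"
  by (simp add: adjugate2_def trace_2 det_2 mat_def algebra_simps)

lemma matrix_inverse_unique:
  fixes A :: "'a::semiring_1 ^ 'n ^ 'n"
  assumes "A ** B = mat 1" "C ** A = mat 1"
  shows "B = C"
  by (metis assms matrix_mul_assoc matrix_mul_lid matrix_mul_rid)

lemma mat_minus_mult_nth:
  fixes M N :: "'a::comm_ring_1 ^ 2 ^ 2"
  shows "((mat k - M) ** N) $ i $ j = k * N $ i $ j - (M ** N) $ i $ j"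
    and "(N ** (mat k - M)) $ i $ j = k * N $ i $ j - (N ** M) $ i $ j"
  using exhaust_2[of i] exhaust_2[of j] by (auto simp: mat_def algebra_simps)

text \<open>The first two are Cayley-Hamilton for \<open>A\<close> multiplied by \<open>M\<close>.
  The third is Cayley-Hamilton for \<open>A ** M\<close> with one factor \<open>M\<close> cancelled
  on the right. The entrywise form suits polynomial arithmetic.\<close>

lemma Cayley_Hamilton_2:
  fixes A M :: "'a::comm_ring_1 ^ 2 ^ 2"
  shows "(M ** A ** A) $ i $ j = trace A * (M ** A) $ i $ j - det A * M $ i $ j"
    and "(A ** A ** M) $ i $ j = trace A * (A ** M) $ i $ j - det A * M $ i $ j"
    and "(A ** M ** A) $ i $ j = trace (A ** M) * A $ i $ j - det A * adjugate2 M $ i $ j"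
  using exhaust_2[of i] exhaust_2[of j]
  by (auto simp: mat_def adjugate2_def trace_2 det_2 algebra_simps)

lemma fig8_relation_iff:
  fixes A B :: "complex ^ 2 ^ 2"
  defines "W \<equiv> adjugate2 A ** B ** A ** adjugate2 B"
  assumes det: "det A = 1" "det B = 1" and tr: "trace A = trace B"
  shows "W ** A = B ** W \<longleftrightarrow> A = B \<or> (trace A, trace (A ** B)) \<in> X0"
proof -
  define x z where "x = trace A" and "z = trace (A ** B)"
  define F where "F = z\<^sup>2 - (1 + x\<^sup>2) * z + 2 * x\<^sup>2 - 1"
  have trBA: "trace (B ** A) = z"
    by (simp add: z_def trace_2 algebra_simps)
  note CH = Cayley_Hamilton_2
  note defs = x_def[symmetric] z_def[symmetric] det tr[symmetric] trBA
  have ABA: "(A ** B ** A) $ i $ j = z * A $ i $ j + B $ i $ j - x * mat 1 $ i $ j"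
    and BAB: "(B ** A ** B) $ i $ j = z * B $ i $ j + A $ i $ j - x * mat 1 $ i $ j" for i j
    using CH(3)[where A = A and M = B] CH(3)[where A = B and M = A]
    by (auto simp: defs adjugate2_def mat_def)
  have AA: "(A ** A) $ i $ j = x * A $ i $ j - mat 1 $ i $ j"
    and BB: "(B ** B) $ i $ j = x * B $ i $ j - mat 1 $ i $ j"
    and ABAB: "(A ** B ** A ** B) $ i $ j = z * (A ** B) $ i $ j - mat 1 $ i $ j"
    and BAA: "(B ** A ** A) $ i $ j = x * (B ** A) $ i $ j - B $ i $ j"
    and BBA: "(B ** (B ** A)) $ i $ j = x * (B ** A) $ i $ j - A $ i $ j" for i j
    using CH(1)[of "mat 1" A i j] CH(1)[of "mat 1" B i j] CH(1)[of "mat 1" "A ** B" i j]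
      CH(1)[of B A i j] CH(2)[of B A i j]
    by (auto simp: defs det_mul matrix_mul_assoc simp del: matrix_mult_2_nth)
  \<comment> \<open>Expanding the inverses as \<open>x - A\<close> and \<open>x - B\<close> and
    reducing the longer words brings \<open>W\<close> into the span of
    \<open>1, A, B, AB, BA\<close>.\<close>
  have W: "W $ i $ j = x\<^sup>2 * (B ** A) $ i $ j + z * (A ** B) $ i $ j
      - x * (z + 1) * (A $ i $ j + B $ i $ j) + (2 * x\<^sup>2 - 1) * mat 1 $ i $ j" for i j
  proof -
    have "W $ i $ j = x * ((mat x - A) ** (B ** A)) $ i $ j
        - ((mat x - A) ** (B ** A ** B)) $ i $ j"
      unfolding W_def adjugate2_def tr[symmetric] x_def[symmetric] mat_minus_mult_nth(2)
      by (simp only: matrix_mul_assoc)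
    also have "\<dots> = x * (x * (B ** A) $ i $ j - (A ** B ** A) $ i $ j)
        - (x * (B ** A ** B) $ i $ j - (A ** B ** A ** B) $ i $ j)"
      unfolding mat_minus_mult_nth(1) by (simp only: matrix_mul_assoc)
    finally show ?thesis
      unfolding ABA BAB ABAB by algebra
  qed
  have WA: "(W ** A) $ i $ j = x\<^sup>2 * (B ** A ** A) $ i $ j + z * (A ** B ** A) $ i $ j
      - x * (z + 1) * ((A ** A) $ i $ j + (B ** A) $ i $ j) + (2 * x\<^sup>2 - 1) * A $ i $ j" for i j
    unfolding matrix_mult_2_nth[of W] matrix_mult_2_nth[of _ A] W
    using matrix_mult_2_nth[of "mat 1" A i j, simplified matrix_mul_lid] by algebra
  have BW: "(B ** W) $ i $ j = x\<^sup>2 * (B ** (B ** A)) $ i $ j + z * (B ** A ** B) $ i $ j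
      - x * (z + 1) * ((B ** A) $ i $ j + (B ** B) $ i $ j) + (2 * x\<^sup>2 - 1) * B $ i $ j" for i j
    unfolding matrix_mul_assoc[of B A B, symmetric]
    unfolding matrix_mult_2_nth[of B] W
    using matrix_mult_2_nth[of B "mat 1" i j, simplified matrix_mul_rid] by algebra
  \<comment> \<open>Both products reduce to combinations of \<open>1, A, B, BA\<close>. In the
    difference the terms in \<open>1\<close> and \<open>BA\<close> cancel, and \<open>A\<close>,
    \<open>B\<close> keep the coefficients \<open>F\<close>, \<open>- F\<close>.\<close>
  have "(W ** A) $ i $ j - (B ** W) $ i $ j = F * (A $ i $ j - B $ i $ j)" for i j
    unfolding WA BW ABA BAB AA BB BAA BBA F_def by algebra
  then have "W ** A = B ** W \<longleftrightarrow> (\<forall>i j. F * (A $ i $ j - B $ i $ j) = 0)"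
    by (metis (no_types, lifting) eq_iff_diff_eq_0 vec_eq_iff)
  then show ?thesis
    by (auto simp: vec_eq_iff F_def X0_def x_def z_def)
qed

section \<open>The group of words modulo the relator\<close>

lemma fig8_eq_context:
  assumes "fig8_eq u v"
  shows "fig8_eq (p @ u @ q) (p @ v @ q)"
  using assms
proof induction
  case (cancel u l v)
  \<comment> \<open>The generating rules act inside an arbitrary word already, so extra context is
    absorbed into theirs.\<close>
  show ?case using fig8_eq.cancel[of "p @ u" l "v @ q"] by simp
next
  case (relator u v)
  show ?case using fig8_eq.relator[of "p @ u" "v @ q"] by simp
next
  case (refl u)
  show ?case by (rule fig8_eq.refl)
next
  case (sym u v)
  show ?case by (rule fig8_eq.sym) fact
next
  case (trans u v w)
  show ?case by (rule fig8_eq.trans) fact+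
qed

lemma fig8_eq_append:
  assumes "fig8_eq u u'" "fig8_eq v v'"
  shows "fig8_eq (u @ v) (u' @ v')"
proof (rule fig8_eq.trans)
  show "fig8_eq (u @ v) (u' @ v)"
    using fig8_eq_context[OF assms(1), of "[]" v] by simp
  show "fig8_eq (u' @ v) (u' @ v')"
    using fig8_eq_context[OF assms(2), of u' "[]"] by simp
qed

lemma fig8_elem_eq_iff: "fig8_elem u = fig8_elem v \<longleftrightarrow> fig8_eq u v"
proof -
  have "equiv UNIV fig8_rel"
    by (rule equivI) (auto simp: fig8_rel_def refl_on_def sym_def trans_def
        intro: fig8_eq.refl fig8_eq.sym fig8_eq.trans)
  from eq_equiv_class_iff[OF this] show ?thesis
    by (simp add: fig8_elem_def fig8_rel_def)
qed

lemma mem_fig8_elem_iff: "v \<in> fig8_elem u \<longleftrightarrow> fig8_eq u v"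
  by (simp add: fig8_elem_def fig8_rel_def)

lemma carrier_fig8_group: "carrier fig8_group = range fig8_elem"
  by (auto simp: fig8_group_def quotient_def fig8_elem_def)

text \<open>The product is a union over all representatives; by congruence every class in this union
  is the same one.\<close>

lemma mult_fig8_group: "fig8_elem u \<otimes>\<^bsub>fig8_group\<^esub> fig8_elem v = fig8_elem (u @ v)"
proof -
  have "fig8_elem (u' @ v') = fig8_elem (u @ v)" if "u' \<in> fig8_elem u" "v' \<in> fig8_elem v" for u' v'
    using that by (metis fig8_elem_eq_iff fig8_eq_append mem_fig8_elem_iff)
  moreover have "u \<in> fig8_elem u" "v \<in> fig8_elem v"
    by (simp_all add: mem_fig8_elem_iff fig8_eq.refl)
  ultimately have "(\<Union>u'\<in>fig8_elem u. \<Union>v'\<in>fig8_elem v. fig8_elem (u' @ v')) = fig8_elem (u @ v)"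
    by blast
  then show ?thesis
    by (simp add: fig8_group_def)
qed

section \<open>Representations as pairs of matrices\<close>

definition word_matrix :: "(letter \<Rightarrow> complex ^ 2 ^ 2) \<Rightarrow> letter list \<Rightarrow> complex ^ 2 ^ 2" where
  "word_matrix f w = foldr (\<lambda>l M. f l ** M) w (mat 1)"

lemma word_matrix_simps [simp]:
  "word_matrix f [] = mat 1"
  "word_matrix f (l # w) = f l ** word_matrix f w"
  by (simp_all add: word_matrix_def)

lemma word_matrix_append [simp]: "word_matrix f (u @ v) = word_matrix f u ** word_matrix f v"
  by (induction u) (simp_all add: matrix_mul_assoc)

lemma word_matrix_cong:
  assumes "fig8_eq u v"
    and "\<And>l. f l ** f (letter_inv l) = mat 1" "word_matrix f fig8_relator = mat 1"
  shows "word_matrix f u = word_matrix f v"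
  using assms(1)
proof induction
  case (cancel u l v)
  have "f l ** (f (letter_inv l) ** word_matrix f v) = word_matrix f v"
    by (simp add: matrix_mul_assoc assms(2))
  then show ?case by simp
qed (simp_all add: assms(3))

lemma det_word_matrix:
  assumes "\<And>l. det (f l) = 1"
  shows "det (word_matrix f w) = 1"
  by (induction w) (simp_all add: det_mul assms)

fun letter_matrix :: "complex ^ 2 ^ 2 \<Rightarrow> complex ^ 2 ^ 2 \<Rightarrow> letter \<Rightarrow> complex ^ 2 ^ 2" where
  "letter_matrix A B Alpha = A"
| "letter_matrix A B Alpha_inv = adjugate2 A"
| "letter_matrix A B Beta = B"
| "letter_matrix A B Beta_inv = adjugate2 B"

text \<open>The relator spells \<open>B^-1 (W A) W^-1\<close>, its last four letters being the
  inverse of \<open>W\<close>.\<close>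

lemma word_matrix_relator_iff:
  assumes "det A = 1" "det B = 1"
  defines "W \<equiv> adjugate2 A ** B ** A ** adjugate2 B"
  shows "word_matrix (letter_matrix A B) fig8_relator = mat 1 \<longleftrightarrow> W ** A = B ** W"
proof -
  define W' where "W' = B ** adjugate2 A ** adjugate2 B ** A"
  note inv = adjugate2_mult[OF assms(1)] adjugate2_mult[OF assms(2)]
  have cancel [simp]: "M ** A ** adjugate2 A = M" "M ** adjugate2 A ** A = M"
    "M ** B ** adjugate2 B = M" "M ** adjugate2 B ** B = M" for M
    by (metis inv matrix_mul_assoc matrix_mul_rid)+
  have WW': "W ** W' = mat 1" "W' ** W = mat 1"
    by (simp_all add: W_def W'_def matrix_mul_assoc inv)
  have rel: "word_matrix (letter_matrix A B) fig8_relator = adjugate2 B ** (W ** A) ** W'"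
    by (simp add: fig8_relator_def W_def W'_def matrix_mul_assoc)
  show ?thesis
    unfolding rel by (metis WW' inv matrix_mul_assoc matrix_mul_lid matrix_mul_rid)
qed

lemma trace_conjugate:
  fixes A B W :: "complex ^ 2 ^ 2"
  assumes "W ** A = B ** W" "W ** V = mat 1"
  shows "trace A = trace B"
proof -
  have "V ** W = mat 1"
    using assms(2) by (simp add: matrix_left_right_inverse)
  then have "trace A = trace (A ** (V ** W))" by simp
  also have "\<dots> = trace (W ** A ** V)"
    by (metis matrix_mul_assoc trace_mul_sym)
  also have "W ** A ** V = B"
    by (metis assms matrix_mul_assoc matrix_mul_rid)
  finally show ?thesis .
qed

lemma fig8_repsD:
  assumes \<rho>: "\<rho> \<in> fig8_reps"
  defines "A \<equiv> \<rho> alpha" and "B \<equiv> \<rho> beta"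
  shows "det A = 1" "det B = 1"
    and "\<rho> (fig8_elem w) = word_matrix (letter_matrix A B) w"
proof -
  have det: "det (\<rho> (fig8_elem w)) = 1" for w
    using \<rho> by (auto simp: fig8_reps_def hom_def SL2C_def carrier_fig8_group)
  have mult: "\<rho> (fig8_elem (u @ v)) = \<rho> (fig8_elem u) ** \<rho> (fig8_elem v)" for u v
    using \<rho> by (auto simp: fig8_reps_def hom_def SL2C_def carrier_fig8_group mult_fig8_group[symmetric])
  show A: "det A = 1" and B: "det B = 1"
    using det by (simp_all add: A_def B_def alpha_def beta_def)
  \<comment> \<open>\<open>hom\<close> only provides multiplicativity: the image of the identity is
    idempotent, and being invertible it is the identity matrix.\<close>
  have one: "\<rho> (fig8_elem []) = mat 1"
    using mult[of "[]" "[]"] adjugate2_mult(2)[OF det[of "[]"]]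
    by (metis append_Nil matrix_mul_assoc matrix_mul_lid)
  have "\<rho> (fig8_elem [l]) ** \<rho> (fig8_elem [letter_inv l]) = mat 1" for l
    using fig8_eq.cancel[of "[]" l "[]"] mult[of "[l]" "[letter_inv l]"] one
    by (metis append.simps fig8_elem_eq_iff)
  from this[of Alpha] this[of Beta]
  have "\<rho> (fig8_elem [Alpha_inv]) = adjugate2 A" "\<rho> (fig8_elem [Beta_inv]) = adjugate2 B"
    using adjugate2_mult[OF A] adjugate2_mult[OF B]
    by (auto simp: A_def B_def alpha_def beta_def intro: matrix_inverse_unique)
  then have "\<rho> (fig8_elem [l]) = letter_matrix A B l" for l
    by (cases l) (simp_all add: A_def B_def alpha_def beta_def)
  then show "\<rho> (fig8_elem w) = word_matrix (letter_matrix A B) w"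
    using mult[of "[_]"] one by (induction w) auto
qed

lemma char_coords_character:
  assumes "\<rho> \<in> fig8_reps"
  shows "char_coords (character \<rho>) = (trace (\<rho> alpha), trace (\<rho> alpha ** \<rho> beta))"
proof -
  have "\<rho> (fig8_elem [Alpha, Beta]) = \<rho> alpha ** \<rho> beta"
    unfolding fig8_repsD(3)[OF assms, of "[Alpha, Beta]"] by simp
  moreover have "alpha \<otimes>\<^bsub>fig8_group\<^esub> beta = fig8_elem [Alpha, Beta]"
    unfolding alpha_def beta_def mult_fig8_group by simp
  ultimately show ?thesis
    unfolding char_coords_def character_def by (simp only:)
qed

lemma fig8_reps_cases:
  assumes "\<rho> \<in> fig8_reps"
  shows "\<rho> alpha = \<rho> beta \<or> char_coords (character \<rho>) \<in> X0"
proof -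
  define A B where "A = \<rho> alpha" and "B = \<rho> beta"
  define W where "W = adjugate2 A ** B ** A ** adjugate2 B"
  note rep = fig8_repsD[OF assms, folded A_def B_def]
  have "word_matrix (letter_matrix A B) fig8_relator = word_matrix (letter_matrix A B) []"
    using fig8_eq.relator[of "[]" "[]"] by (metis append.simps append_Nil2 rep(3) fig8_elem_eq_iff)
  then have "W ** A = B ** W"
    using word_matrix_relator_iff[OF rep(1,2)] by (simp add: W_def)
  \<comment> \<open>\<open>W\<close> is invertible, so the relation makes \<open>A\<close> and
    \<open>B\<close> conjugate; this supplies the equal traces required by
    \<open>fig8_relation_iff\<close>.\<close>
  moreover have "det W = 1"
    by (simp add: W_def det_mul rep(1,2))
  ultimately show ?thesis
    using fig8_relation_iff[OF rep(1,2)] trace_conjugate[OF _ adjugate2_mult(1)]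
    by (metis A_def B_def W_def assms char_coords_character)
qed

lemma fig8_rep_exists:
  assumes "det A = 1" "det B = 1" "trace A = trace B" "(trace A, trace (A ** B)) \<in> X0"
  obtains \<rho> where "\<rho> \<in> fig8_reps" "\<rho> alpha = A" "\<rho> beta = B"
proof
  define f where "f = letter_matrix A B"
  \<comment> \<open>A class is sent to the matrix of a chosen word in it; since the relator maps to
    the identity, the choice does not matter.\<close>
  define \<rho> where "\<rho> = (\<lambda>C. word_matrix f (SOME w. w \<in> C))"
  have detf: "det (f l) = 1" for l
    using assms by (cases l) (auto simp: f_def)
  have "f l ** f (letter_inv l) = mat 1" for l
    using assms by (cases l) (auto simp: f_def adjugate2_mult)
  moreover have "word_matrix f fig8_relator = mat 1"
    unfolding f_def using assms by (simp add: word_matrix_relator_iff fig8_relation_iff)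
  ultimately have "word_matrix f u = word_matrix f v" if "fig8_eq u v" for u v
    using that by (rule word_matrix_cong[rotated])
  moreover have "fig8_eq w (SOME v. v \<in> fig8_elem w)" for w
    by (rule someI2[of _ w]) (simp_all add: mem_fig8_elem_iff fig8_eq.refl)
  ultimately have \<rho>: "\<rho> (fig8_elem w) = word_matrix f w" for w
    unfolding \<rho>_def by metis
  then show "\<rho> \<in> fig8_reps"
    using detf
    by (auto simp: fig8_reps_def hom_def SL2C_def carrier_fig8_group mult_fig8_group det_word_matrix)
  show "\<rho> alpha = A" "\<rho> beta = B"
    by (simp_all add: alpha_def beta_def \<rho> f_def)
qed

lemma X0_rep_exists:
  assumes "(x, z) \<in> X0"
  obtains \<rho> where "\<rho> \<in> fig8_reps" "char_coords (character \<rho>) = (x, z)" "\<rho> alpha \<noteq> \<rho> beta"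
proof -
  \<comment> \<open>\<open>m\<close> solves \<open>m^2 - x m + 1 = 0\<close>, so \<open>m\<close>
    and \<open>x - m\<close> are the inverse eigenvalues of both matrices. The trace of
    \<open>A ** B\<close> is \<open>x^2 - 2 + t\<close>, which fixes \<open>t\<close>.\<close>
  define m where "m = (x + csqrt (x\<^sup>2 - 4)) / 2"
  define t where "t = z - x\<^sup>2 + 2"
  define A B :: "complex ^ 2 ^ 2" where
    "A = vector [vector [m, 1], vector [0, x - m]]" and
    "B = vector [vector [m, 0], vector [t, x - m]]"
  have "(csqrt (x\<^sup>2 - 4))\<^sup>2 = x\<^sup>2 - 4" by simp
  then have m: "m * (x - m) = 1"
    unfolding m_def by (simp add: field_simps power2_eq_square)
  have det: "det A = 1" "det B = 1"
    using m by (simp_all add: A_def B_def det_2)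
  have tr: "trace A = x" "trace B = x"
    by (simp_all add: A_def B_def trace_2)
  have trAB: "trace (A ** B) = z"
    using m by (simp add: A_def B_def trace_2 t_def) algebra
  have "A \<noteq> B"
    by (simp add: A_def B_def square_matrix_2_eq_iff)
  with fig8_rep_exists[OF det] tr trAB assms that show thesis
    by (metis char_coords_character)
qed

section \<open>The character variety between \<open>X0\<close> and its union with a parabola\<close>

lemma fig8_char_variety_subset: "fig8_char_variety \<subseteq> X0 \<union> {(x, z). z = x\<^sup>2 - 2}"
proof
  fix c assume "c \<in> fig8_char_variety"
  then obtain \<rho> where \<rho>: "\<rho> \<in> fig8_reps" and c: "c = char_coords (character \<rho>)"
    by (auto simp: fig8_char_variety_def)
  have "c \<in> {(x, z). z = x\<^sup>2 - 2}" if "\<rho> alpha = \<rho> beta"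
  proof -
    have "trace (A ** A) = (trace A)\<^sup>2 - 2 * det A" for A :: "complex ^ 2 ^ 2"
      by (simp add: trace_2 det_2 power2_eq_square algebra_simps)
    then show ?thesis
      using that fig8_repsD(1)[OF \<rho>] by (simp add: c char_coords_character[OF \<rho>])
  qed
  moreover have "c \<in> X0" if "\<rho> alpha \<noteq> \<rho> beta"
    using that fig8_reps_cases[OF \<rho>] unfolding c by simp
  ultimately show "c \<in> X0 \<union> {(x, z). z = x\<^sup>2 - 2}"
    by (cases "\<rho> alpha = \<rho> beta") (simp_all only: Un_iff simp_thms)
qed

lemma X0_subset_fig8_char_variety: "X0 \<subseteq> fig8_char_variety"
proof clarify
  fix x z assume "(x, z) \<in> X0"
  then obtain \<rho> where "\<rho> \<in> fig8_reps" "char_coords (character \<rho>) = (x, z)"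
    by (rule X0_rep_exists)
  then show "(x, z) \<in> fig8_char_variety"
    unfolding fig8_char_variety_def by (metis imageI)
qed

text \<open>A representation over a point of \<open>X0\<close> separates the generators;
  \<open>(1, 1)\<close> is a convenient point.\<close>

lemma alpha_neq_beta: "alpha \<noteq> beta"
proof -
  have "(1, 1) \<in> X0" by (simp add: X0_def)
  from X0_rep_exists[OF this] show ?thesis by metis
qed

lemma discrete_faithful_X0:
  assumes "discrete_faithful \<rho>"
  shows "char_coords (character \<rho>) \<in> X0"
proof -
  have \<rho>: "\<rho> \<in> fig8_reps" and inj: "inj_on \<rho> (carrier fig8_group)"
    using assms by (auto simp: discrete_faithful_def)
  have "\<rho> alpha \<noteq> \<rho> beta"
    using inj_onD[OF inj, of alpha beta] alpha_neq_beta
    unfolding carrier_fig8_group alpha_def beta_def by blast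
  then show ?thesis
    using fig8_reps_cases[OF \<rho>] by blast
qed

section \<open>The component \<open>X0\<close>\<close>

text \<open>The equation of \<open>X0\<close> is monic of degree two in \<open>z\<close>, so
  division by it leaves a remainder linear in \<open>z\<close>.\<close>

lemma eval2_reduce_X0:
  "\<exists>a b. \<forall>(x, z)\<in>X0. eval2 p x z = poly a x + poly b x * z"
proof (induction p)
  case 0
  show ?case by (intro exI[of _ 0]) (auto simp: eval2_def)
next
  case (pCons c p)
  then obtain a b where ab: "\<And>x z. (x, z) \<in> X0 \<Longrightarrow> eval2 p x z = poly a x + poly b x * z"
    by blast
  \<comment> \<open>Multiplying \<open>a + b z\<close> by \<open>z\<close> and substituting
    \<open>z^2 = (1 - 2 x^2) + (1 + x^2) z\<close> gives these coefficients.\<close>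
  have "eval2 (pCons c p) x z
      = poly (c + b * [:1, 0, -2:]) x + poly (a + b * [:1, 0, 1:]) x * z" if "(x, z) \<in> X0" for x z
  proof -
    have "z * z = (1 + x\<^sup>2) * z - 2 * x\<^sup>2 + 1"
      using that by (simp add: X0_def power2_eq_square algebra_simps)
    moreover have "eval2 (pCons c p) x z = poly c x + z * eval2 p x z"
      by (simp add: eval2_def)
    ultimately have "eval2 (pCons c p) x z
        = poly c x + poly a x * z + poly b x * ((1 + x\<^sup>2) * z - 2 * x\<^sup>2 + 1)"
      using ab[OF that] by algebra
    then show ?thesis
      by (simp add: algebra_simps power2_eq_square)
  qed
  then show ?case by blast
qed

text \<open>The norm of \<open>a + b z\<close> from the coordinate ring of \<open>X0\<close> down to \<open>\<complex>[x]\<close>.\<close>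

definition norm_X0 :: "complex poly \<Rightarrow> complex poly \<Rightarrow> complex poly" where
  "norm_X0 a b = a\<^sup>2 + a * b * [:1, 0, 1:] + b\<^sup>2 * [:-1, 0, 2:]"

text \<open>The discriminant \<open>(x\<^sup>2 - 1) (x\<^sup>2 - 5)\<close> is not a square, as it vanishes to order one at \<open>1\<close>.\<close>

lemma norm_X0_eq_0_iff: "norm_X0 a b = 0 \<longleftrightarrow> a = 0 \<and> b = 0"
proof
  assume N: "norm_X0 a b = 0"
  \<comment> \<open>Completing the square turns four times the norm into \<open>c^2\<close> minus
    \<open>b^2\<close> times the discriminant; \<open>r\<close> is the cofactor
    \<open>(x + 1) (x^2 - 5)\<close> of \<open>x - 1\<close>.\<close>
  define c where "c = 2 * a + b * [:1, 0, 1:]"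
  define r where "r = [:-5, -5, 1, 1 :: complex:]"
  have "[:1, 0, 1:]\<^sup>2 - 4 * [:-1, 0, 2:] = [:-1, 1:] * r"
    by (simp add: r_def power2_eq_square numeral_poly)
  moreover have "c\<^sup>2 - b\<^sup>2 * ([:1, 0, 1:]\<^sup>2 - 4 * [:-1, 0, 2:]) = 4 * norm_X0 a b"
    unfolding c_def norm_X0_def by algebra
  ultimately have c2: "c\<^sup>2 = b\<^sup>2 * ([:-1, 1:] * r)"
    using N by simp
  have "b = 0"
  proof (rule ccontr)
    assume "b \<noteq> 0"
    have "r \<noteq> 0" and "poly r 1 \<noteq> 0" by (simp_all add: r_def)
    have nz: "b\<^sup>2 * ([:-1, 1:] * r) \<noteq> 0"
      using \<open>b \<noteq> 0\<close> \<open>r \<noteq> 0\<close> by (simp del: mult_pCons_left)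
    then have nz': "[:-1, 1:] * r \<noteq> 0"
      by (metis mult_zero_right)
    have "c \<noteq> 0" using nz c2 by auto
    \<comment> \<open>The order at \<open>1\<close> is even on the left of \<open>c2\<close> and odd
      on the right.\<close>
    have "order 1 (c\<^sup>2) = 2 * order 1 c"
      using \<open>c \<noteq> 0\<close> by (simp add: power2_eq_square order_mult)
    moreover have "order 1 (b\<^sup>2 * ([:-1, 1:] * r)) = order 1 (b\<^sup>2) + (order 1 [:-1, 1 :: complex:] + order 1 r)"
      by (simp only: order_mult[OF nz] order_mult[OF nz'])
    moreover have "order 1 (b\<^sup>2) = 2 * order 1 b"
      using \<open>b \<noteq> 0\<close> by (simp add: power2_eq_square order_mult)
    moreover have "order 1 r = 0"
      using \<open>poly r 1 \<noteq> 0\<close> by (rule order_0I)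
    moreover have "order 1 [:-1, 1 :: complex:] = 1"
      using order_power_n_n[of "1::complex" 1] by simp
    ultimately show False using arg_cong[OF c2, of "order 1"] by presburger
  qed
  then show "a = 0 \<and> b = 0"
    using N by (simp add: norm_X0_def)
qed (simp add: norm_X0_def)

text \<open>A monic quadratic in \<open>z\<close> always has a complex root; hence \<open>X0\<close>
  projects onto the whole \<open>x\<close>-line and norms can be tested at every
  \<open>x\<close>.\<close>

lemma X0_root_exists: "\<exists>z. (x, z) \<in> X0"
proof -
  define s where "s = csqrt ((1 + x\<^sup>2)\<^sup>2 - 4 * (2 * x\<^sup>2 - 1))"
  have s: "s\<^sup>2 = (1 + x\<^sup>2)\<^sup>2 - 4 * (2 * x\<^sup>2 - 1)" by (simp add: s_def)
  then have "(x, (1 + x\<^sup>2 + s) / 2) \<in> X0"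
    using s by (simp add: X0_def field_simps power2_eq_square) algebra
  then show ?thesis by blast
qed

text \<open>By Vieta the other root over \<open>x\<close> is \<open>1 + x^2 - z\<close>, so the norm
  is the product of \<open>a + b z\<close> with its conjugate.\<close>

lemma poly_norm_X0:
  assumes "(x, z) \<in> X0"
  shows "poly (norm_X0 a b) x
    = (poly a x + poly b x * z) * (poly a x + poly b x * (1 + x\<^sup>2 - z))"
proof -
  have "z * (1 + x\<^sup>2 - z) = 2 * x\<^sup>2 - 1"
    using assms by (simp add: X0_def power2_eq_square algebra_simps)
  moreover have "poly (norm_X0 a b) x
      = (poly a x)\<^sup>2 + poly a x * poly b x * (1 + x\<^sup>2) + (poly b x)\<^sup>2 * (2 * x\<^sup>2 - 1)"
    by (simp add: norm_X0_def power2_eq_square algebra_simps)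
  ultimately show ?thesis by algebra
qed

text \<open>This is primality of the ideal of \<open>X0\<close>: the product of the two norms
  vanishes at every \<open>x\<close>, so one norm is the zero polynomial and its remainder is
  zero.\<close>

lemma eval2_mult_vanishes_on_X0:
  assumes "\<And>x z. (x, z) \<in> X0 \<Longrightarrow> eval2 p x z = 0 \<or> eval2 q x z = 0"
  shows "(\<forall>(x, z)\<in>X0. eval2 p x z = 0) \<or> (\<forall>(x, z)\<in>X0. eval2 q x z = 0)"
proof -
  obtain a b where p: "\<And>x z. (x, z) \<in> X0 \<Longrightarrow> eval2 p x z = poly a x + poly b x * z"
    using eval2_reduce_X0 by blast
  obtain c d where q: "\<And>x z. (x, z) \<in> X0 \<Longrightarrow> eval2 q x z = poly c x + poly d x * z"
    using eval2_reduce_X0 by blast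
  have "poly (norm_X0 a b * norm_X0 c d) x = 0" for x
  proof -
    obtain z where "(x, z) \<in> X0" using X0_root_exists by blast
    then show ?thesis using assms p q by (fastforce simp: poly_norm_X0)
  qed
  then have "norm_X0 a b = 0 \<or> norm_X0 c d = 0"
    by (metis mult_eq_0_iff poly_all_0_iff_0)
  then show ?thesis
    using p q by (auto simp: norm_X0_eq_0_iff)
qed

lemma zariski_irreducible_X0: "zariski_irreducible X0"
  unfolding zariski_irreducible_def
proof (intro conjI allI impI)
  show "X0 \<noteq> {}" using X0_root_exists by blast
next
  fix V W
  assume "affine_closed V" "affine_closed W" and sub: "X0 \<subseteq> V \<union> W"
  then obtain P Q where V: "V = {(x, z). \<forall>p\<in>P. eval2 p x z = 0}"
    and W: "W = {(x, z). \<forall>q\<in>Q. eval2 q x z = 0}"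
    unfolding affine_closed_def by blast
  show "X0 \<subseteq> V \<or> X0 \<subseteq> W"
  proof (rule ccontr)
    assume "\<not> (X0 \<subseteq> V \<or> X0 \<subseteq> W)"
    then obtain p q where pq: "p \<in> P" "q \<in> Q"
      and "\<not> (\<forall>(x, z)\<in>X0. eval2 p x z = 0)" "\<not> (\<forall>(x, z)\<in>X0. eval2 q x z = 0)"
      unfolding V W by blast
    moreover have "eval2 p x z = 0 \<or> eval2 q x z = 0" if "(x, z) \<in> X0" for x z
      using that sub pq unfolding V W by blast
    ultimately show False
      using eval2_mult_vanishes_on_X0 by blast
  qed
qed

lemma affine_closed_X0: "affine_closed X0"
  unfolding affine_closed_def X0_def
  by (intro exI[of _ "{[: [:-1, 0, 2:], [:-1, 0, -1:], 1 :]}"])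
    (auto simp: eval2_def power2_eq_square algebra_simps)

lemma affine_closed_parabola: "affine_closed {(x, z). z = x\<^sup>2 - 2}"
  unfolding affine_closed_def
  by (intro exI[of _ "{[: [:2, 0, -1:], 1 :]}"])
    (auto simp: eval2_def power2_eq_square algebra_simps)

text \<open>A larger irreducible set would lie in one of two closed curves, and the point
  \<open>(1, 1)\<close> of \<open>X0\<close> is off the parabola.\<close>

lemma irreducible_component_X0: "irreducible_component X0 fig8_char_variety"
  unfolding irreducible_component_def
proof (intro conjI allI impI)
  fix T assume T: "X0 \<subseteq> T" "T \<subseteq> fig8_char_variety" "zariski_irreducible T"
  have "T \<subseteq> X0 \<union> {(x, z). z = x\<^sup>2 - 2}"
    using T(2) fig8_char_variety_subset by (rule order_trans)
  then have "T \<subseteq> X0 \<or> T \<subseteq> {(x, z). z = x\<^sup>2 - 2}"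
    using T(3) affine_closed_X0 affine_closed_parabola unfolding zariski_irreducible_def by blast
  moreover have "\<not> T \<subseteq> {(x, z). z = x\<^sup>2 - 2}"
  proof
    assume "T \<subseteq> {(x, z). z = x\<^sup>2 - 2}"
    moreover have "(1, 1) \<in> T" using T(1) by (auto simp: X0_def)
    ultimately show False by auto
  qed
  ultimately show "T = X0" using T(1) by blast
qed (rule X0_subset_fig8_char_variety zariski_irreducible_X0)+

section \<open>The projective model\<close>

lemma hpt_eq_iff:
  assumes "(X, Y, Z) \<noteq> (0, 0, 0)"
  shows "hpt X Y Z = hpt X' Y' Z' \<longleftrightarrow> (\<exists>c. c \<noteq> 0 \<and> X' = c * X \<and> Y' = c * Y \<and> Z' = c * Z)"
proof
  assume eq: "hpt X Y Z = hpt X' Y' Z'"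
  \<comment> \<open>A nonzero triple lies in its own class whereas \<open>hpt 0 0 0\<close> is
    empty, so equality forces the second triple to be nonzero too.\<close>
  have "(X, Y, Z) \<in> hpt X Y Z"
    using assms by (auto simp: hpt_def proj_rel_def intro: exI[of _ 1])
  then have "(X', Y', Z') \<noteq> (0, 0, 0)"
    unfolding eq by (auto simp: hpt_def proj_rel_def)
  then have "(X', Y', Z') \<in> hpt X' Y' Z'"
    by (auto simp: hpt_def proj_rel_def intro: exI[of _ 1])
  then show "\<exists>c. c \<noteq> 0 \<and> X' = c * X \<and> Y' = c * Y \<and> Z' = c * Z"
    unfolding eq[symmetric] by (auto simp: hpt_def proj_rel_def)
next
  assume "\<exists>c. c \<noteq> 0 \<and> X' = c * X \<and> Y' = c * Y \<and> Z' = c * Z"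
  then obtain c where c: "c \<noteq> 0" "X' = c * X" "Y' = c * Y" "Z' = c * Z" by blast
  have "(\<exists>k. k \<noteq> 0 \<and> U = k * X \<and> V = k * Y \<and> W = k * Z) \<longleftrightarrow>
      (\<exists>k. k \<noteq> 0 \<and> U = k * X' \<and> V = k * Y' \<and> W = k * Z')" for U V W
  proof
    assume "\<exists>k. k \<noteq> 0 \<and> U = k * X \<and> V = k * Y \<and> W = k * Z"
    then obtain k where "k \<noteq> 0" "U = k * X" "V = k * Y" "W = k * Z" by blast
    then show "\<exists>k. k \<noteq> 0 \<and> U = k * X' \<and> V = k * Y' \<and> W = k * Z'"
      using c by (intro exI[of _ "k / c"]) auto
  next
    assume "\<exists>k. k \<noteq> 0 \<and> U = k * X' \<and> V = k * Y' \<and> W = k * Z'"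
    then obtain k where "k \<noteq> 0" "U = k * X'" "V = k * Y'" "W = k * Z'" by blast
    then show "\<exists>k. k \<noteq> 0 \<and> U = k * X \<and> V = k * Y \<and> W = k * Z"
      using c by (intro exI[of _ "k * c"]) auto
  qed
  moreover have "(X', Y', Z') \<noteq> (0, 0, 0)" using assms c by auto
  ultimately show "hpt X Y Z = hpt X' Y' Z'"
    using assms by (auto simp: hpt_def proj_rel_def)
qed

text \<open>Homogeneity carries vanishing from one representative of a point to all of them.\<close>

lemma proj_zeros_hpt_iff:
  assumes "\<And>F. F \<in> P \<Longrightarrow> homogeneous F" "(X, Y, Z) \<noteq> (0, 0, 0)"
  shows "hpt X Y Z \<in> proj_zeros P \<longleftrightarrow> (\<forall>F\<in>P. eval3 F X Y Z = 0)"
proof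
  assume "hpt X Y Z \<in> proj_zeros P"
  then obtain X' Y' Z' where "hpt X' Y' Z' = hpt X Y Z" "(X', Y', Z') \<noteq> (0, 0, 0)"
    and zero: "\<And>F. F \<in> P \<Longrightarrow> eval3 F X' Y' Z' = 0"
    unfolding proj_zeros_def by fastforce
  then obtain c where "X = c * X'" "Y = c * Y'" "Z = c * Z'"
    using hpt_eq_iff by metis
  then show "\<forall>F\<in>P. eval3 F X Y Z = 0"
    using assms(1) zero unfolding homogeneous_def by fastforce
qed (use assms(2) in \<open>auto simp: proj_zeros_def\<close>)

definition X0_form :: "complex poly poly poly" where
  "X0_form = [: [:0, [:0, 0, 2:], 0, -1:], [:[:0, 0, -1:], 0, -1:], [:0, 1:] :]"

definition Y_form :: "complex poly poly poly" where
  "Y_form = [: [:0, 1:] :]"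

lemma eval3_X0_form:
  "eval3 X0_form X Y Z = Y * Z\<^sup>2 - Y\<^sup>2 * Z - X\<^sup>2 * Z + 2 * X\<^sup>2 * Y - Y ^ 3"
  by (simp add: eval3_def X0_form_def power2_eq_square power3_eq_cube algebra_simps)

lemma eval3_Y_form [simp]: "eval3 Y_form X Y Z = Y"
  by (simp add: eval3_def Y_form_def)

lemma homogeneous_X0_form: "homogeneous X0_form"
  unfolding homogeneous_def eval3_X0_form
  by (intro exI[of _ 3]) (simp add: power2_eq_square power3_eq_cube algebra_simps)

lemma homogeneous_Y_form: "homogeneous Y_form"
  unfolding homogeneous_def by (intro exI[of _ 1]) simp

lemma X0_model_eq: "X0_model = proj_zeros {X0_form}"
  by (simp add: X0_model_def proj_zeros_def eval3_X0_form)

lemma hpt_mem_X0_model_iff: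
  assumes "(X, Y, Z) \<noteq> (0, 0, 0)"
  shows "hpt X Y Z \<in> X0_model \<longleftrightarrow> eval3 X0_form X Y Z = 0"
  unfolding X0_model_eq
  by (subst proj_zeros_hpt_iff) (use assms homogeneous_X0_form in auto)

lemma smooth_X0_model: "smooth_plane_curve X0_model"
  unfolding smooth_plane_curve_def
proof (intro exI[of _ X0_form] conjI allI impI notI)
  fix X Y Z :: complex
  assume nz: "(X, Y, Z) \<noteq> (0, 0, 0)" and "eval3 X0_form X Y Z = 0"
    and "deriv (\<lambda>t. eval3 X0_form t Y Z) X = 0 \<and>
      deriv (\<lambda>t. eval3 X0_form X t Z) Y = 0 \<and> deriv (\<lambda>t. eval3 X0_form X Y t) Z = 0"
  moreover have "deriv (\<lambda>t. eval3 X0_form t Y Z) X = 2 * X * (2 * Y - Z)"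
    unfolding eval3_X0_form
    by (rule DERIV_imp_deriv) (auto intro!: derivative_eq_intros simp: algebra_simps)
  moreover have "deriv (\<lambda>t. eval3 X0_form X t Z) Y = Z\<^sup>2 - 2 * Y * Z + 2 * X\<^sup>2 - 3 * Y\<^sup>2"
    unfolding eval3_X0_form
    by (rule DERIV_imp_deriv) (auto intro!: derivative_eq_intros simp: algebra_simps)
  moreover have "deriv (\<lambda>t. eval3 X0_form X Y t) Z = 2 * Y * Z - Y\<^sup>2 - X\<^sup>2"
    unfolding eval3_X0_form
    by (rule DERIV_imp_deriv) (auto intro!: derivative_eq_intros simp: algebra_simps)
  ultimately have FX: "X = 0 \<or> Z = 2 * Y"
    and FY: "Z\<^sup>2 - 2 * Y * Z + 2 * X\<^sup>2 - 3 * Y\<^sup>2 = 0"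
    and FZ: "2 * Y * Z - Y\<^sup>2 - X\<^sup>2 = 0"
    by auto
  \<comment> \<open>The \<open>X\<close>-derivative factors as \<open>2 X (2 Y - Z)\<close>. In
    either case the other two derivatives leave only the zero triple; for \<open>X = 0\<close> their
    sum is \<open>Z^2 - 4 Y^2\<close>.\<close>
  from FX show False
  proof
    assume "X = 0"
    then have "4 * (Z\<^sup>2 - 4 * Y\<^sup>2) = 0" "Y * (2 * Z - Y) = 0"
      using FY FZ by algebra+
    then show False using nz \<open>X = 0\<close>
      by (auto simp: power2_eq_square)
  next
    assume "Z = 2 * Y"
    then have "3 * Y\<^sup>2 = 0" "X\<^sup>2 = 3 * Y\<^sup>2"
      using FY FZ by algebra+
    then show False using nz \<open>Z = 2 * Y\<close> by auto
  qed
qed (simp_all add: homogeneous_X0_form X0_model_eq)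

section \<open>The affine chart and the line at infinity\<close>

lemma affine_embed_X0: "affine_embed ` X0 = {hpt x 1 z | x z. eval3 X0_form x 1 z = 0}"
proof -
  have "(x, z) \<in> X0 \<longleftrightarrow> eval3 X0_form x 1 z = 0" for x z
    unfolding X0_def eval3_X0_form by (simp add: algebra_simps)
  then show ?thesis by (auto simp: affine_embed_def)
qed

lemma hpt_mem_affine_embed_X0:
  assumes "(X, Y, Z) \<noteq> (0, 0, 0)" "hpt X Y Z \<in> X0_model"
  shows "hpt X Y Z \<in> affine_embed ` X0 \<longleftrightarrow> Y \<noteq> 0"
proof
  assume "hpt X Y Z \<in> affine_embed ` X0"
  then show "Y \<noteq> 0"
    using assms by (auto simp: affine_embed_X0 hpt_eq_iff)
next
  assume "Y \<noteq> 0"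
  then have eq: "hpt X Y Z = hpt (X / Y) 1 (Z / Y)"
    using assms(1) by (subst hpt_eq_iff) (auto intro: exI[of _ "1 / Y"])
  then have "eval3 X0_form (X / Y) 1 (Z / Y) = 0"
    using assms hpt_mem_X0_model_iff[of "X / Y" 1 "Z / Y"] by simp
  then show "hpt X Y Z \<in> affine_embed ` X0"
    unfolding affine_embed_X0 eq by blast
qed

lemma affine_embed_X0_subset: "affine_embed ` X0 \<subseteq> X0_model"
proof
  fix p assume "p \<in> affine_embed ` X0"
  then obtain x z where "p = hpt x 1 z" "eval3 X0_form x 1 z = 0"
    unfolding affine_embed_X0 by blast
  then show "p \<in> X0_model"
    using hpt_mem_X0_model_iff[of x 1 z] by simp
qed

lemma ideal_points_X0: "ideal_points X0 X0_model = {hpt 1 0 0, hpt 0 0 1}"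
proof
  show "ideal_points X0 X0_model \<subseteq> {hpt 1 0 0, hpt 0 0 1}"
  proof
    fix p assume "p \<in> ideal_points X0 X0_model"
    then have p: "p \<in> X0_model" "p \<notin> affine_embed ` X0" by (auto simp: ideal_points_def)
    then obtain X Y Z where XYZ: "p = hpt X Y Z" "(X, Y, Z) \<noteq> (0, 0, 0)"
      and F: "eval3 X0_form X Y Z = 0"
      by (auto simp: X0_model_eq proj_zeros_def)
    then have "Y = 0" using p hpt_mem_affine_embed_X0 by blast
    then have "X = 0 \<or> Z = 0" using F by (simp add: eval3_X0_form)
    then have "p = hpt 1 0 0 \<or> p = hpt 0 0 1"
      using XYZ \<open>Y = 0\<close> by (auto simp: hpt_eq_iff intro: exI[of _ "1 / X"] exI[of _ "1 / Z"])
    then show "p \<in> {hpt 1 0 0, hpt 0 0 1}" by blast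
  qed
  have "hpt 1 0 0 \<in> X0_model" "hpt 0 0 1 \<in> X0_model"
    by (simp_all add: hpt_mem_X0_model_iff eval3_X0_form)
  then show "{hpt 1 0 0, hpt 0 0 1} \<subseteq> ideal_points X0 X0_model"
    by (auto simp: ideal_points_def hpt_mem_affine_embed_X0)
qed

lemma card_ideal_points_X0: "card (ideal_points X0 X0_model) = 2"
proof -
  have "hpt 1 0 0 \<noteq> hpt 0 0 1" by (subst hpt_eq_iff) auto
  then show ?thesis by (simp add: ideal_points_X0)
qed

text \<open>Adding the form \<open>Y\<close> to the equation cuts out exactly the points outside the
  chart.\<close>

lemma proj_closed_ideal_points_X0: "proj_closed (X0_model - affine_embed ` X0)"
proof -
  have hom: "homogeneous F" if "F \<in> {X0_form, Y_form}" for F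
    using that homogeneous_X0_form homogeneous_Y_form by blast
  have "proj_zeros {X0_form, Y_form} = X0_model - affine_embed ` X0"
  proof (intro equalityI subsetI)
    fix p assume "p \<in> proj_zeros {X0_form, Y_form}"
    then obtain X Y Z where XYZ: "p = hpt X Y Z" "(X, Y, Z) \<noteq> (0, 0, 0)"
      and "eval3 X0_form X Y Z = 0" "Y = 0"
      by (auto simp: proj_zeros_def)
    then show "p \<in> X0_model - affine_embed ` X0"
      using hpt_mem_affine_embed_X0[OF XYZ(2)] hpt_mem_X0_model_iff[OF XYZ(2)] by simp
  next
    fix p assume p: "p \<in> X0_model - affine_embed ` X0"
    then obtain X Y Z where XYZ: "p = hpt X Y Z" "(X, Y, Z) \<noteq> (0, 0, 0)"
      and F: "eval3 X0_form X Y Z = 0"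
      by (auto simp: X0_model_eq proj_zeros_def)
    then have "Y = 0" using p hpt_mem_affine_embed_X0 by blast
    then show "p \<in> proj_zeros {X0_form, Y_form}"
      using XYZ F by (auto simp: proj_zeros_def)
  qed
  then show ?thesis
    unfolding proj_closed_def using hom by metis
qed

section \<open>Density of the affine curve in its projective model\<close>

lemma tendsto_csqrt_0:
  assumes "(f \<longlongrightarrow> 0) F"
  shows "((\<lambda>n. csqrt (f n)) \<longlongrightarrow> 0) F"
\<comment> \<open>\<open>csqrt\<close> jumps across the negative real axis, but at \<open>0\<close>
  convergence of its norm suffices.\<close>
proof (rule tendsto_norm_zero_cancel)
  have "((\<lambda>n. sqrt (norm (f n))) \<longlongrightarrow> sqrt 0) F"
    by (intro tendsto_real_sqrt tendsto_norm_zero assms)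
  then show "((\<lambda>n. norm (csqrt (f n))) \<longlongrightarrow> 0) F" by simp
qed

lemma tendsto_eval3:
  assumes "X \<longlonglongrightarrow> x" "Y \<longlonglongrightarrow> y" "Z \<longlonglongrightarrow> z"
  shows "(\<lambda>n. eval3 F (X n) (Y n) (Z n)) \<longlonglongrightarrow> eval3 F x y z"
proof -
  have poly2: "(\<lambda>n. poly (poly p [:Y n:]) (X n)) \<longlonglongrightarrow> poly (poly p [:y:]) x" for p
    by (induction p) (auto intro!: tendsto_intros tendsto_poly assms)
  show ?thesis
    unfolding eval3_def
    by (induction F) (auto intro!: tendsto_intros poly2 assms)
qed

text \<open>The ideal points lie in the closure of the affine curve even for the Euclidean topology.\<close>

lemma X0_model_minimal:
  assumes "proj_closed V" "affine_embed ` X0 \<subseteq> V"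
  shows "X0_model \<subseteq> V"
proof -
  obtain P where hom: "\<And>F. F \<in> P \<Longrightarrow> homogeneous F" and V: "V = proj_zeros P"
    using assms(1) unfolding proj_closed_def by blast
  have zero: "eval3 F X Y Z = 0" if "F \<in> P" "Y \<noteq> 0" "eval3 X0_form X Y Z = 0" for F X Y Z
  proof -
    have nz: "(X, Y, Z) \<noteq> (0, 0, 0)" using that by auto
    then have "hpt X Y Z \<in> X0_model"
      using that by (auto simp: X0_model_eq proj_zeros_def)
    then have "hpt X Y Z \<in> V"
      using assms(2) hpt_mem_affine_embed_X0[OF nz] that by blast
    then show ?thesis
      using that proj_zeros_hpt_iff[OF hom nz] by (auto simp: V)
  qed
  \<comment> \<open>The forms defining \<open>V\<close> vanish on the affine part of the curve,
    hence by continuity at limits of its homogeneous coordinates.\<close>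
  have limit: "hpt X Y Z \<in> V"
    if "\<And>n. eval3 X0_form (f n) (g n) (h n) = 0" "\<And>n. g n \<noteq> 0"
      "f \<longlonglongrightarrow> X" "g \<longlonglongrightarrow> Y" "h \<longlonglongrightarrow> Z" "(X, Y, Z) \<noteq> (0, 0, 0)" for f g h X Y Z
  proof -
    have "eval3 F X Y Z = 0" if "F \<in> P" for F
    proof -
      have "(\<lambda>n. eval3 F (f n) (g n) (h n)) \<longlonglongrightarrow> eval3 F X Y Z"
        by (rule tendsto_eval3) fact+
      moreover have "eval3 F (f n) (g n) (h n) = 0" for n
        using zero \<open>F \<in> P\<close> \<open>\<And>n. eval3 X0_form (f n) (g n) (h n) = 0\<close> \<open>\<And>n. g n \<noteq> 0\<close> by blast
      ultimately show ?thesis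
        by (simp add: LIMSEQ_const_iff)
    qed
    then show ?thesis
      using that proj_zeros_hpt_iff[OF hom] by (auto simp: V)
  qed
  text \<open>On \<open>X0\<close> one has \<open>x\<^sup>2 = (z\<^sup>2 - z - 1) / (z - 2)\<close>; the two ideal points are approached
    along \<open>z = 2 + e\<close> and \<open>z = - 1 / e\<close> as \<open>e\<close> tends to \<open>0\<close>.\<close>
  define e where "e = (\<lambda>n. complex_of_real (inverse (real (Suc n))))"
  have e: "e \<longlonglongrightarrow> 0"
    using tendsto_of_real[OF LIMSEQ_inverse_real_of_nat, where 'a = complex] by (simp add: e_def)
  have pos: "0 < inverse (real (Suc n))" for n by simp
  have e0: "e n \<noteq> 0" for n by (simp add: e_def del: of_nat_Suc)
  \<comment> \<open>These are \<open>z^2 - z - 1\<close> at \<open>z = 2 + e\<close> and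
    \<open>- e (z - 2)\<close> at \<open>z = - 1 / e\<close>, the denominators below; they are
    nonzero because \<open>e\<close> is real and positive.\<close>
  have e1: "1 + 3 * e n + (e n)\<^sup>2 \<noteq> 0" and e2: "1 + 2 * e n \<noteq> 0" for n
  proof -
    define r where "r = inverse (real (Suc n))"
    have "1 + 3 * r + r\<^sup>2 \<noteq> 0" "1 + 2 * r \<noteq> 0"
      using pos[of n] by (smt (verit) r_def zero_le_power2)+
    then have "complex_of_real (1 + 3 * r + r\<^sup>2) \<noteq> 0" "complex_of_real (1 + 2 * r) \<noteq> 0"
      by (simp_all only: of_real_eq_0_iff not_False_eq_True)
    then show "1 + 3 * e n + (e n)\<^sup>2 \<noteq> 0" "1 + 2 * e n \<noteq> 0"
      by (simp_all add: e_def r_def)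
  qed
  have "hpt 1 0 0 \<in> V"
  proof -
    \<comment> \<open>Coordinates are scaled to \<open>X = 1\<close>: then \<open>Y = 1 / x\<close>
      and \<open>Z = z / x\<close>, with \<open>w = 1 / x^2\<close> at
      \<open>z = 2 + e\<close>.\<close>
    define w where "w = (\<lambda>n. e n / (1 + 3 * e n + (e n)\<^sup>2))"
    define s where "s = (\<lambda>n. csqrt (w n))"
    have "w \<longlonglongrightarrow> 0"
      unfolding w_def by (rule tendsto_eq_intros e | simp)+
    then have s: "s \<longlonglongrightarrow> 0"
      unfolding s_def by (rule tendsto_csqrt_0)
    have s2: "(s n)\<^sup>2 * (1 + 3 * e n + (e n)\<^sup>2) = e n" for n
      using e1[of n] by (simp add: s_def w_def)
    show ?thesis
    proof (rule limit)
      show "eval3 X0_form 1 (s n) ((2 + e n) * s n) = 0" for n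
      proof -
        have "eval3 X0_form 1 (s n) ((2 + e n) * s n)
            = s n * ((s n)\<^sup>2 * (1 + 3 * e n + (e n)\<^sup>2) - e n)"
          unfolding eval3_X0_form by (simp add: power2_eq_square power3_eq_cube algebra_simps)
        then show ?thesis by (simp add: s2)
      qed
      show "s n \<noteq> 0" for n
        using s2[of n] e0[of n] by auto
      show "(\<lambda>n. (2 + e n) * s n) \<longlonglongrightarrow> 0"
        by (rule tendsto_eq_intros e s | simp)+
    qed (use s in auto)
  qed
  moreover have "hpt 0 0 1 \<in> V"
  proof -
    \<comment> \<open>Coordinates are scaled to \<open>Z = 1\<close>: then
      \<open>Y = 1 / z = - e\<close> and \<open>X = x / z\<close>, whose square is
      \<open>w\<close>.\<close>
    define w where "w = (\<lambda>n. - e n * (1 + e n - (e n)\<^sup>2) / (1 + 2 * e n))"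
    define s where "s = (\<lambda>n. csqrt (w n))"
    have "w \<longlonglongrightarrow> 0"
      unfolding w_def by (rule tendsto_eq_intros e | simp)+
    then have s: "s \<longlonglongrightarrow> 0"
      unfolding s_def by (rule tendsto_csqrt_0)
    have s2: "(s n)\<^sup>2 * (1 + 2 * e n) = - e n * (1 + e n - (e n)\<^sup>2)" for n
      using e2[of n] by (simp add: s_def w_def)
    show ?thesis
    proof (rule limit)
      show "eval3 X0_form (s n) (- e n) 1 = 0" for n
      proof -
        have "eval3 X0_form (s n) (- e n) 1
            = - e n * (1 + e n - (e n)\<^sup>2) - (s n)\<^sup>2 * (1 + 2 * e n)"
          unfolding eval3_X0_form by (simp add: power2_eq_square power3_eq_cube algebra_simps)
        then show ?thesis by (simp add: s2)
      qed
      show "- e n \<noteq> 0" for n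
        using e0[of n] by simp
      show "(\<lambda>n. - e n) \<longlonglongrightarrow> 0"
        using tendsto_minus[OF e] by simp
    qed (use s in auto)
  qed
  ultimately have "ideal_points X0 X0_model \<subseteq> V"
    by (simp add: ideal_points_X0)
  then show ?thesis
    using assms(2) by (auto simp: ideal_points_def)
qed

theorem corollary5p6:
  shows "irreducible_component X0 fig8_char_variety \<and>
         (\<forall>\<rho>. discrete_faithful \<rho> \<longrightarrow> char_coords (character \<rho>) \<in> X0) \<and>
         smooth_projective_model X0 X0_model \<and>
         ideal_points X0 X0_model = {hpt 1 0 0, hpt 0 0 1} \<and>
         card (ideal_points X0 X0_model) = 2"
proof (intro conjI allI impI)
  show "smooth_projective_model X0 X0_model"
    unfolding smooth_projective_model_def
    using smooth_X0_model affine_embed_X0_subset proj_closed_ideal_points_X0 X0_model_minimal by blast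
qed (fact irreducible_component_X0 discrete_faithful_X0 ideal_points_X0 card_ideal_points_X0)+

end
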